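(* Every finite woven poset $P$ can be unravelled; that is, there is a sequence $P=P_n\supseteq\dots\supseteq P_0=\emptyset$ of subposets of $P$ (each with the order induced from $P$) such that every $P_i$ is a woven poset and $|P_i\setminus P_{i-1}|=1$ for every $1\le i\le n$.
   Context: A finite poset $Q$ is woven if any two elements $p,q\in Q$ have a supremum in $Q$ or an infimum in $Q$ (existence computed within $Q$ itself: a supremum is an $r\in Q$ with $p\le r$, $q\le r$ and $r\le s$ for every $s\in Q$ with $p\le s$ and $q\le s$; an infimum is defined dually). The empty poset is woven. *)

theory Defs
  imports "HOL-Algebra.Order"
begin

text \<open>
  A poset is a structure satisfying \<^locale>\<open>partial_order\<close>. Both bounds are computed inside the
  carrier, because \<^const>\<open>Upper\<close> and \<^const>\<open>Lower\<close> only collect elements of the carrier.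
\<close>

definition woven :: "('a, 'b) gorder_scheme \<Rightarrow> bool" where
  "woven L \<longleftrightarrow> finite (carrier L) \<and> partial_order L \<and>
     (\<forall>p\<in>carrier L. \<forall>q\<in>carrier L.
        (\<exists>r. least L r (Upper L {p, q})) \<or> (\<exists>r. greatest L r (Lower L {p, q})))"

definition subposet :: "('a, 'b) gorder_scheme \<Rightarrow> 'a set \<Rightarrow> ('a, 'b) gorder_scheme" where
  "subposet L Q = L\<lparr>carrier := Q\<rparr>"

text \<open>
  The sequence is given by its carriers \<open>S 0, \<dots>, S n\<close>; values of \<open>S\<close> beyond \<open>n\<close> are irrelevant.
\<close>

definition can_be_unravelled :: "('a, 'b) gorder_scheme \<Rightarrow> bool" where
  "can_be_unravelled L \<longleftrightarrow>
     (\<exists>(n::nat) S. S n = carrier L \<and> S 0 = {} \<and>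
        (\<forall>i\<le>n. woven (subposet L (S i))) \<and>
        (\<forall>i\<in>{1..n}. S (i - 1) \<subseteq> S i \<and> card (S i - S (i - 1)) = 1))"

end

theory Submission
  imports Defs
begin

text \<open>
  The point is that every nonempty finite woven poset has an element whose removal leaves a woven
  poset; the theorem then follows by induction on the number of elements.

  If every two elements have an infimum, any maximal element can go, since it is never the infimum
  of two others. Otherwise choose \<open>u\<close> minimal among the elements that lack an infimum with some
  element, and then \<open>c\<close> maximal among the elements lacking an infimum with \<open>u\<close>. As the poset is
  woven, \<open>x = sup {c, u}\<close> exists, and the choice of \<open>u\<close> and \<open>c\<close> forces every element strictly above
  \<open>c\<close> to be above \<open>x\<close> (lemma \<open>above_extremal_pair\<close>): above \<open>c\<close> the poset continues only through
  \<open>x\<close>. Such an element is harmless (lemma \<open>woven_remove_bottleneck\<close>). It is not the infimum of two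
  other elements, because those would lie above \<open>x\<close>; and two elements whose supremum was \<open>c\<close>
  have the supremum \<open>x\<close> once \<open>c\<close> is gone.
\<close>

section \<open>Suprema and infima of pairs\<close>

text \<open>
  The bounds of a pair are written out with quantifiers over the carrier, so that their behaviour
  under passing to a smaller carrier can be read off.
\<close>

definition is_sup :: "('a, 'b) gorder_scheme \<Rightarrow> 'a \<Rightarrow> 'a \<Rightarrow> 'a \<Rightarrow> bool" where
  "is_sup L p q r \<longleftrightarrow> r \<in> carrier L \<and> p \<sqsubseteq>\<^bsub>L\<^esub> r \<and> q \<sqsubseteq>\<^bsub>L\<^esub> r \<and>
     (\<forall>s\<in>carrier L. p \<sqsubseteq>\<^bsub>L\<^esub> s \<and> q \<sqsubseteq>\<^bsub>L\<^esub> s \<longrightarrow> r \<sqsubseteq>\<^bsub>L\<^esub> s)"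

definition is_inf :: "('a, 'b) gorder_scheme \<Rightarrow> 'a \<Rightarrow> 'a \<Rightarrow> 'a \<Rightarrow> bool" where
  "is_inf L p q r \<longleftrightarrow> r \<in> carrier L \<and> r \<sqsubseteq>\<^bsub>L\<^esub> p \<and> r \<sqsubseteq>\<^bsub>L\<^esub> q \<and>
     (\<forall>s\<in>carrier L. s \<sqsubseteq>\<^bsub>L\<^esub> p \<and> s \<sqsubseteq>\<^bsub>L\<^esub> q \<longrightarrow> s \<sqsubseteq>\<^bsub>L\<^esub> r)"

lemma least_Upper_iff_is_sup:
  assumes "p \<in> carrier L" "q \<in> carrier L"
  shows "least L r (Upper L {p, q}) \<longleftrightarrow> is_sup L p q r"
  using assms by (auto simp: least_def Upper_def is_sup_def)

lemma greatest_Lower_iff_is_inf: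
  assumes "p \<in> carrier L" "q \<in> carrier L"
  shows "greatest L r (Lower L {p, q}) \<longleftrightarrow> is_inf L p q r"
  using assms by (auto simp: greatest_def Lower_def is_inf_def)

lemma woven_iff:
  "woven L \<longleftrightarrow> finite (carrier L) \<and> partial_order L \<and>
     (\<forall>p\<in>carrier L. \<forall>q\<in>carrier L. (\<exists>r. is_sup L p q r) \<or> (\<exists>r. is_inf L p q r))"
  by (simp add: woven_def least_Upper_iff_is_sup greatest_Lower_iff_is_inf cong: ball_cong)

section \<open>Subposets\<close>

lemma carrier_subposet [simp]: "carrier (subposet L Q) = Q"
  by (simp add: subposet_def)

lemma le_subposet [simp]: "p \<sqsubseteq>\<^bsub>subposet L Q\<^esub> q \<longleftrightarrow> p \<sqsubseteq>\<^bsub>L\<^esub> q"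
  by (simp add: subposet_def)

lemma subposet_subposet [simp]: "subposet (subposet L Q) R = subposet L R"
  by (simp add: subposet_def)

lemma subposet_carrier [simp]: "subposet L (carrier L) = L"
  by (simp add: subposet_def)

lemma partial_order_subposet:
  assumes "partial_order L" "Q \<subseteq> carrier L"
  shows "partial_order (subposet L Q)"
proof -
  interpret partial_order L by fact
  have trans: "x \<sqsubseteq>\<^bsub>L\<^esub> z" if "x \<sqsubseteq>\<^bsub>L\<^esub> y" "y \<sqsubseteq>\<^bsub>L\<^esub> z" "x \<in> Q" "y \<in> Q" "z \<in> Q" for x y z
    using that assms(2) le_trans[of x y z] by auto
  have antisym: "x = y" if "x \<sqsubseteq>\<^bsub>L\<^esub> y" "y \<sqsubseteq>\<^bsub>L\<^esub> x" "x \<in> Q" "y \<in> Q" for x y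
    using that assms(2) le_antisym[of x y] by auto
  have refl: "x \<sqsubseteq>\<^bsub>L\<^esub> x" if "x \<in> Q" for x
    using that assms(2) by auto
  show ?thesis
    by unfold_locales
      (use antisym refl in \<open>simp_all add: subposet_def eq_is_equal\<close>, blast intro: trans)
qed

lemma is_sup_subposet:
  assumes "is_sup L p q r" "r \<in> Q" "Q \<subseteq> carrier L"
  shows "is_sup (subposet L Q) p q r"
  using assms by (auto simp: is_sup_def)

lemma is_inf_subposet:
  assumes "is_inf L p q r" "r \<in> Q" "Q \<subseteq> carrier L"
  shows "is_inf (subposet L Q) p q r"
  using assms by (auto simp: is_inf_def)

section \<open>Elements that can be removed\<close>

text \<open>
  As \<open>x\<close> is the only upper cover of \<open>c\<close>, it takes over the role of \<open>c\<close> as a supremum once \<open>c\<close> is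
  gone; and \<open>c\<close> has no role as an infimum, because two other elements above \<open>c\<close> are both above \<open>x\<close>.
\<close>

lemma woven_remove_bottleneck:
  assumes L: "woven L"
    and x: "x \<in> carrier L" "c \<sqsubseteq>\<^bsub>L\<^esub> x" "x \<noteq> c"
    and c: "c \<in> carrier L"
    and above: "\<And>z. z \<in> carrier L \<Longrightarrow> c \<sqsubseteq>\<^bsub>L\<^esub> z \<Longrightarrow> z \<noteq> c \<Longrightarrow> x \<sqsubseteq>\<^bsub>L\<^esub> z"
  shows "woven (subposet L (carrier L - {c}))"
proof -
  interpret partial_order L using L by (simp add: woven_iff)
  let ?L = "subposet L (carrier L - {c})"
  have "(\<exists>r. is_sup ?L p q r) \<or> (\<exists>r. is_inf ?L p q r)"
    if p: "p \<in> carrier L - {c}" and q: "q \<in> carrier L - {c}" for p q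
  proof -
    have "(\<exists>r. is_sup L p q r) \<or> (\<exists>r. is_inf L p q r)"
      using L p q by (simp add: woven_iff)
    then show ?thesis
    proof (elim disjE exE)
      fix r assume r: "is_sup L p q r"
      show ?thesis
      proof (cases "r = c")
        case True
        then have "p \<sqsubseteq>\<^bsub>L\<^esub> c" "q \<sqsubseteq>\<^bsub>L\<^esub> c"
          using r by (simp_all add: is_sup_def)
        then have "p \<sqsubseteq>\<^bsub>L\<^esub> x" "q \<sqsubseteq>\<^bsub>L\<^esub> x"
          using le_trans[OF _ x(2) _ c x(1)] p q by blast+
        moreover have "x \<sqsubseteq>\<^bsub>L\<^esub> s"
          if "s \<in> carrier L" "s \<noteq> c" "p \<sqsubseteq>\<^bsub>L\<^esub> s" "q \<sqsubseteq>\<^bsub>L\<^esub> s" for s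
          using r True that above by (auto simp: is_sup_def)
        ultimately have "is_sup ?L p q x"
          using x by (auto simp: is_sup_def)
        then show ?thesis by blast
      next
        case False
        then have "is_sup ?L p q r"
          using r by (intro is_sup_subposet) (auto simp: is_sup_def)
        then show ?thesis by blast
      qed
    next
      fix r assume r: "is_inf L p q r"
      have "r \<noteq> c"
      proof
        assume "r = c"
        \<comment> \<open>Then \<open>x\<close> is a lower bound of \<open>p\<close> and \<open>q\<close> that lies strictly above their infimum.\<close>
        then have "x \<sqsubseteq>\<^bsub>L\<^esub> p" "x \<sqsubseteq>\<^bsub>L\<^esub> q"
          using r p q above by (auto simp: is_inf_def)
        then have "x \<sqsubseteq>\<^bsub>L\<^esub> c"
          using r \<open>r = c\<close> x by (simp add: is_inf_def)
        then show False
          using x c le_antisym by blast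
      qed
      then have "is_inf ?L p q r"
        using r by (intro is_inf_subposet) (auto simp: is_inf_def)
      then show ?thesis by blast
    qed
  qed
  then show ?thesis
    using L partial_order_subposet[of L "carrier L - {c}"] by (auto simp: woven_iff)
qed

lemma woven_remove_maximal:
  assumes L: "woven L"
    and inf: "\<And>p q. p \<in> carrier L \<Longrightarrow> q \<in> carrier L \<Longrightarrow> \<exists>r. is_inf L p q r"
    and c: "c \<in> carrier L"
    and maximal: "\<And>z. z \<in> carrier L \<Longrightarrow> c \<sqsubseteq>\<^bsub>L\<^esub> z \<Longrightarrow> z = c"
  shows "woven (subposet L (carrier L - {c}))"
proof -
  let ?L = "subposet L (carrier L - {c})"
  have "\<exists>r. is_inf ?L p q r"
    if p: "p \<in> carrier L - {c}" and q: "q \<in> carrier L - {c}" for p q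
  proof -
    obtain r where r: "is_inf L p q r" using inf p q by blast
    then have "r \<noteq> c" using maximal[of p] p by (auto simp: is_inf_def)
    then show ?thesis
      using r by (intro exI[of _ r] is_inf_subposet) (auto simp: is_inf_def)
  qed
  then show ?thesis
    using L partial_order_subposet[of L "carrier L - {c}"] by (auto simp: woven_iff)
qed

lemma exists_maximal:
  assumes "partial_order L" "finite A" "A \<noteq> {}" "A \<subseteq> carrier L"
  shows "\<exists>m\<in>A. \<forall>z\<in>A. m \<sqsubseteq>\<^bsub>L\<^esub> z \<longrightarrow> z = m"
proof -
  interpret partial_order L by fact
  have "asymp_on A (\<lambda>a b. a \<sqsubseteq>\<^bsub>L\<^esub> b \<and> a \<noteq> b)"
    using assms(4) le_antisym by (auto intro!: asymp_onI)
  moreover have "transp_on A (\<lambda>a b. a \<sqsubseteq>\<^bsub>L\<^esub> b \<and> a \<noteq> b)"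
  proof (rule transp_onI)
    fix a b d
    assume "a \<in> A" "b \<in> A" "d \<in> A"
      and ab: "a \<sqsubseteq>\<^bsub>L\<^esub> b \<and> a \<noteq> b" and bd: "b \<sqsubseteq>\<^bsub>L\<^esub> d \<and> b \<noteq> d"
    then have in_L: "a \<in> carrier L" "b \<in> carrier L" "d \<in> carrier L"
      using assms(4) by auto
    then have "a \<sqsubseteq>\<^bsub>L\<^esub> d" using ab bd le_trans[of a b d] by blast
    moreover have "a \<noteq> d" using ab bd in_L le_antisym[of a b] by blast
    ultimately show "a \<sqsubseteq>\<^bsub>L\<^esub> d \<and> a \<noteq> d" by blast
  qed
  ultimately show ?thesis
    using Finite_Set.bex_max_element[OF assms(2), of "\<lambda>a b. a \<sqsubseteq>\<^bsub>L\<^esub> b \<and> a \<noteq> b"] assms(3) by blast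
qed

lemma exists_minimal:
  assumes "partial_order L" "finite A" "A \<noteq> {}" "A \<subseteq> carrier L"
  shows "\<exists>m\<in>A. \<forall>z\<in>A. z \<sqsubseteq>\<^bsub>L\<^esub> m \<longrightarrow> z = m"
proof -
  have "\<exists>m\<in>A. \<forall>z\<in>A. m \<sqsubseteq>\<^bsub>inv_gorder L\<^esub> z \<longrightarrow> z = m"
    using assms partial_order.dual_order[of L] by (intro exists_maximal) auto
  then show ?thesis by simp
qed

text \<open>
  Let \<open>z\<close> lie strictly above \<open>c\<close>. By maximality of \<open>c\<close> there is
  \<open>e = inf {z, u}\<close>, and since \<open>c\<close> is below \<open>z\<close>, the pairs \<open>{e, c}\<close> and \<open>{c, u}\<close> have the same lower
  bounds, so that \<open>{e, c}\<close> has no infimum. By minimality of \<open>u\<close> this leaves only \<open>e = u\<close>, that is,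
  \<open>u\<close> is below \<open>z\<close>.
\<close>

lemma above_extremal_pair:
  assumes "partial_order L"
    and c: "c \<in> carrier L" and u: "u \<in> carrier L"
    and no_inf: "\<nexists>r. is_inf L c u r"
    and minimal: "\<And>e d. e \<in> carrier L \<Longrightarrow> e \<sqsubseteq>\<^bsub>L\<^esub> u \<Longrightarrow> e \<noteq> u \<Longrightarrow> d \<in> carrier L \<Longrightarrow> \<exists>r. is_inf L d e r"
    and maximal: "\<And>z. z \<in> carrier L \<Longrightarrow> c \<sqsubseteq>\<^bsub>L\<^esub> z \<Longrightarrow> z \<noteq> c \<Longrightarrow> \<exists>r. is_inf L z u r"
    and x: "is_sup L c u x"
    and z: "z \<in> carrier L" "c \<sqsubseteq>\<^bsub>L\<^esub> z" "z \<noteq> c"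
  shows "x \<sqsubseteq>\<^bsub>L\<^esub> z"
proof -
  interpret partial_order L by fact
  obtain e where e: "is_inf L z u e"
    using maximal z by blast
  then have e_props: "e \<in> carrier L" "e \<sqsubseteq>\<^bsub>L\<^esub> z" "e \<sqsubseteq>\<^bsub>L\<^esub> u"
    by (auto simp: is_inf_def)
  have lower: "s \<sqsubseteq>\<^bsub>L\<^esub> u \<longleftrightarrow> s \<sqsubseteq>\<^bsub>L\<^esub> e" if "s \<in> carrier L" "s \<sqsubseteq>\<^bsub>L\<^esub> c" for s
    using that e e_props c u z le_trans[of s c z] le_trans[of s e u] by (auto simp: is_inf_def)
  have "e = u"
  proof (rule ccontr)
    assume "e \<noteq> u"
    then obtain r where "is_inf L c e r"
      using minimal e_props c by blast
    then have "is_inf L c u r"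
      using lower by (auto simp: is_inf_def)
    then show False
      using no_inf by blast
  qed
  then have "u \<sqsubseteq>\<^bsub>L\<^esub> z" using e_props by simp
  then show ?thesis using x z by (auto simp: is_sup_def)
qed

lemma woven_removable_element:
  assumes L: "woven L" and nonempty: "carrier L \<noteq> {}"
  obtains c where "c \<in> carrier L" "woven (subposet L (carrier L - {c}))"
proof (cases "\<forall>p\<in>carrier L. \<forall>q\<in>carrier L. \<exists>r. is_inf L p q r")
  case True
  obtain c where "c \<in> carrier L" "\<And>z. z \<in> carrier L \<Longrightarrow> c \<sqsubseteq>\<^bsub>L\<^esub> z \<Longrightarrow> z = c"
    using exists_maximal[of L "carrier L"] L nonempty by (auto simp: woven_iff)
  then show ?thesis
    using woven_remove_maximal[of L c] L True that by blast
next
  case False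
  have po: "partial_order L" and fin: "finite (carrier L)"
    using L by (auto simp: woven_iff)
  interpret partial_order L by fact
  define partners where "partners v = {d \<in> carrier L. \<nexists>r. is_inf L d v r}" for v
  let ?B = "{v \<in> carrier L. partners v \<noteq> {}}"
  obtain u where u: "u \<in> ?B" and u_min: "\<And>e. e \<in> ?B \<Longrightarrow> e \<sqsubseteq>\<^bsub>L\<^esub> u \<Longrightarrow> e = u"
    using exists_minimal[of L ?B] po fin False by (auto simp: partners_def)
  obtain c where c: "c \<in> partners u"
    and c_max: "\<And>z. z \<in> partners u \<Longrightarrow> c \<sqsubseteq>\<^bsub>L\<^esub> z \<Longrightarrow> z = c"
    using exists_maximal[of L "partners u"] po fin u by (auto simp: partners_def)
  have carrier: "c \<in> carrier L" "u \<in> carrier L" and no_inf: "\<nexists>r. is_inf L c u r"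
    using c u by (auto simp: partners_def)
  then obtain x where x: "is_sup L c u x"
    using L unfolding woven_iff by blast
  have "x \<noteq> c"
  proof
    assume "x = c"
    then have "is_inf L c u u"
      using x carrier by (auto simp: is_sup_def is_inf_def)
    then show False using no_inf by blast
  qed
  moreover have "x \<sqsubseteq>\<^bsub>L\<^esub> z" if "z \<in> carrier L" "c \<sqsubseteq>\<^bsub>L\<^esub> z" "z \<noteq> c" for z
  proof (rule above_extremal_pair[OF po carrier no_inf _ _ x that])
    show "\<exists>r. is_inf L d e r"
      if "e \<in> carrier L" "e \<sqsubseteq>\<^bsub>L\<^esub> u" "e \<noteq> u" "d \<in> carrier L" for e d
      using u_min[of e] that by (auto simp: partners_def)
    show "\<exists>r. is_inf L z u r"
      if "z \<in> carrier L" "c \<sqsubseteq>\<^bsub>L\<^esub> z" "z \<noteq> c" for z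
      using c_max[of z] that by (auto simp: partners_def)
  qed
  ultimately have "woven (subposet L (carrier L - {c}))"
    using x carrier L by (intro woven_remove_bottleneck[of L x c]) (auto simp: is_sup_def)
  then show ?thesis using that carrier by blast
qed

section \<open>Unravelling\<close>

theorem theorem3:
  fixes P :: "('a, 'b) gorder_scheme"
  assumes "woven P"
  shows "can_be_unravelled P"
  using assms
proof (induction "card (carrier P)" arbitrary: P)
  case 0
  then have "carrier P = {}" by (simp add: woven_iff)
  then have "subposet P {} = P" using subposet_carrier[of P] by simp
  then show ?case
    unfolding can_be_unravelled_def using \<open>carrier P = {}\<close> \<open>woven P\<close>
    by (intro exI[of _ 0] exI[of _ "\<lambda>_. {}"]) simp
next
  case (Suc k)
  have fin: "finite (carrier P)" using Suc.prems by (simp add: woven_iff)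
  have "carrier P \<noteq> {}" using Suc.hyps(2) by auto
  then obtain c where c: "c \<in> carrier P" and woven: "woven (subposet P (carrier P - {c}))"
    using woven_removable_element[OF Suc.prems] by blast
  have "can_be_unravelled (subposet P (carrier P - {c}))"
    using Suc.hyps c fin woven by (intro Suc.hyps(1)) auto
  then obtain n :: nat and S where
    "S n = carrier P - {c} \<and> S 0 = {} \<and> (\<forall>i\<le>n. woven (subposet P (S i))) \<and>
     (\<forall>i\<in>{1..n}. S (i - 1) \<subseteq> S i \<and> card (S i - S (i - 1)) = 1)"
    unfolding can_be_unravelled_def carrier_subposet subposet_subposet by (elim exE)
  then have S: "S n = carrier P - {c}" "S 0 = {}"
      "\<And>i. i \<le> n \<Longrightarrow> woven (subposet P (S i))"
      "\<And>i. i \<in> {1..n} \<Longrightarrow> S (i - 1) \<subseteq> S i \<and> card (S i - S (i - 1)) = 1"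
    by simp_all
  let ?S = "S(Suc n := carrier P)"
  have "carrier P - (carrier P - {c}) = {c}" using c by auto
  then have "?S (i - 1) \<subseteq> ?S i \<and> card (?S i - ?S (i - 1)) = 1" if "i \<in> {1..Suc n}" for i
    using S that by (cases "i = Suc n") auto
  moreover have "woven (subposet P (?S i))" if "i \<le> Suc n" for i
    using S that Suc.prems by (cases "i = Suc n") auto
  ultimately show ?case
    unfolding can_be_unravelled_def using S
    by (intro exI[of _ "Suc n"] exI[of _ ?S]) simp
qed

end
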